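(* Let $X$ be a Riesz space, let $n\geq 1$ be an integer, and let $B_1,\dots,B_n$ be projection bands in $X$. Then $B_1+\cdots+B_n=\{x_1+\cdots+x_n \mid x_i\in B_i \text{ for } 1\leq i\leq n\}$ is a projection band in $X$, and $$P_{B_1+\cdots+B_n}=\sum_{k=1}^{n}(-1)^{k-1}\sum_{1\leq i_1<\cdots<i_k\leq n}P_{B_{i_1}\cap\cdots\cap B_{i_k}},$$ that is, $$P_{B_1+\cdots+B_n}=\sum_{i=1}^nP_{B_i}-\sum_{1\leq i_1<i_2\leq n}P_{B_{i_1}\cap B_{i_2}}+\cdots+(-1)^{k-1}\sum_{1\leq i_1<\cdots<i_k\leq n}P_{B_{i_1}\cap\cdots\cap B_{i_k}}+\cdots+(-1)^{n-1}P_{B_1\cap\cdots\cap B_n}.$$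
   Context: A Riesz space (vector lattice) is a real ordered vector space in which every pair of elements has a supremum and an infimum; $|x|=x\vee(-x)$. An ideal is a vector subspace $Y$ that is solid: $|x|\leq|y|$ and $y\in Y$ imply $x\in Y$. A net $(x_\alpha)$ order-converges to $x$ if there is a net $(y_\alpha)$ with the same index set with $|x_\alpha-x|\leq y_\alpha\downarrow 0$. A band is an order-closed ideal (it contains the limits of all its order-convergent nets). The disjoint complement of a subset $A\subseteq X$ is $A^d=\{x\in X\mid |x|\wedge|y|=0\text{ for all }y\in A\}$. A band $B$ in $X$ is a projection band if $X=B\oplus B^d$. In that case every $x\in X$ is uniquely $x=x_1+x_2$ with $x_1\in B$, $x_2\in B^d$, and the band projection associated with $B$ is the map $P_B:X\to X$, $P_B(x)=x_1$. Finite intersections of projection bands are projection bands, so the operators on the right-hand side are defined. *)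

theory Defs
  imports "HOL-Library.Lattice_Algebras"
begin

class riesz_space = ordered_real_vector + lattice_ab_group_add_abs

definition solid :: "'a::riesz_space set \<Rightarrow> bool" where
  "solid Y \<longleftrightarrow> (\<forall>x. \<forall>y\<in>Y. \<bar>x\<bar> \<le> \<bar>y\<bar> \<longrightarrow> x \<in> Y)"

definition riesz_ideal :: "'a::riesz_space set \<Rightarrow> bool" where
  "riesz_ideal Y \<longleftrightarrow> subspace Y \<and> solid Y"

definition directed_set :: "'i set \<Rightarrow> ('i \<Rightarrow> 'i \<Rightarrow> bool) \<Rightarrow> bool" where
  "directed_set I r \<longleftrightarrow>
     I \<noteq> {} \<and> reflp_on I r \<and> transp_on I r \<and>
     (\<forall>a\<in>I. \<forall>b\<in>I. \<exists>c\<in>I. r a c \<and> r b c)"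

definition decreases_to_0 ::
    "'i set \<Rightarrow> ('i \<Rightarrow> 'i \<Rightarrow> bool) \<Rightarrow> ('i \<Rightarrow> 'a::riesz_space) \<Rightarrow> bool" where
  "decreases_to_0 I r y \<longleftrightarrow>
     monotone_on I r (\<ge>) y \<and>
     (\<forall>a\<in>I. 0 \<le> y a) \<and> (\<forall>z. (\<forall>a\<in>I. z \<le> y a) \<longrightarrow> z \<le> 0)"

definition order_converges ::
    "'i set \<Rightarrow> ('i \<Rightarrow> 'i \<Rightarrow> bool) \<Rightarrow> ('i \<Rightarrow> 'a::riesz_space) \<Rightarrow> 'a \<Rightarrow> bool" where
  "order_converges I r x l \<longleftrightarrow>
     (\<exists>y. decreases_to_0 I r y \<and> (\<forall>a\<in>I. \<bar>x a - l\<bar> \<le> y a))"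

text \<open>A definition cannot quantify over the type of the index set. The nets below are indexed
  by subsets of the space itself; this is no restriction, by \<open>order_closed_net\<close>.\<close>

definition order_closed :: "'a::riesz_space set \<Rightarrow> bool" where
  "order_closed A \<longleftrightarrow>
     (\<forall>(I::'a set) r x l. directed_set I r \<longrightarrow> (\<forall>a\<in>I. x a \<in> A) \<longrightarrow>
        order_converges I r x l \<longrightarrow> l \<in> A)"

lemma order_closed_net:
  fixes A :: "'a::riesz_space set" and I :: "'i set"
  assumes "order_closed A" and dir: "directed_set I r"
    and xA: "\<forall>a\<in>I. x a \<in> A" and conv: "order_converges I r x l"
  shows "l \<in> A"
proof -
  obtain y where y: "decreases_to_0 I r y" and xy: "\<forall>a\<in>I. \<bar>x a - l\<bar> \<le> y a"
    using conv by (auto simp: order_converges_def)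
  define g where "g = inv_into I y"
  have g: "g u \<in> I" "y (g u) = u" if "u \<in> y ` I" for u
    using that by (auto simp: g_def inv_into_into f_inv_into_f)
  have "\<exists>w\<in>y ` I. w \<le> u \<and> w \<le> v" if uv: "u \<in> y ` I" "v \<in> y ` I" for u v
  proof -
    obtain a b where ab: "a \<in> I" "b \<in> I" "u = y a" "v = y b"
      using uv by blast
    then obtain c where c: "c \<in> I" "r a c" "r b c"
      using dir unfolding directed_set_def by meson
    have "y c \<le> y a" "y c \<le> y b"
      using y ab c unfolding decreases_to_0_def monotone_on_def by auto
    with ab c show ?thesis by blast
  qed
  then have "directed_set (y ` I) (\<ge>)"
    using dir unfolding directed_set_def
    by (auto intro!: reflp_onI transp_onI)
  moreover have "\<forall>u\<in>y ` I. x (g u) \<in> A"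
    using g xA by blast
  moreover have "order_converges (y ` I) (\<ge>) (\<lambda>u. x (g u)) l"
    unfolding order_converges_def
  proof (intro exI conjI ballI)
    show "decreases_to_0 (y ` I) (\<ge>) (\<lambda>u. u)"
      using y by (auto simp: decreases_to_0_def monotone_on_def)
    show "\<bar>x (g u) - l\<bar> \<le> u" if "u \<in> y ` I" for u
      using xy g[OF that] by metis
  qed
  ultimately show ?thesis
    using assms(1)[unfolded order_closed_def, rule_format, of "y ` I" "(\<ge>)" "\<lambda>u. x (g u)" l]
    by blast
qed

definition band :: "'a::riesz_space set \<Rightarrow> bool" where
  "band B \<longleftrightarrow> riesz_ideal B \<and> order_closed B"

definition disjoint_complement :: "'a::riesz_space set \<Rightarrow> 'a set" where
  "disjoint_complement A = {x. \<forall>y\<in>A. inf \<bar>x\<bar> \<bar>y\<bar> = 0}"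

definition projection_band :: "'a::riesz_space set \<Rightarrow> bool" where
  "projection_band B \<longleftrightarrow>
     band B \<and> B \<inter> disjoint_complement B = {0} \<and>
     (\<forall>x. \<exists>u\<in>B. \<exists>v\<in>disjoint_complement B. x = u + v)"

definition band_projection :: "'a::riesz_space set \<Rightarrow> 'a \<Rightarrow> 'a" where
  "band_projection B x = (THE u. u \<in> B \<and> (\<exists>v\<in>disjoint_complement B. x = u + v))"

end

(* Band projections are exactly the linear idempotents P with 0 \<le> P x \<le> x for x \<ge> 0. Such
   operators commute, hence are closed under composition and under P \<mapsto> I - P. Composition
   corresponds to intersection of the bands, and I - (I - P)(I - Q) is the projection onto the sum
   of the bands. Therefore I - P_{B_1 + ... + B_n} = (I - P_{B_1}) ... (I - P_{B_n}), and expanding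
   this product gives the inclusion-exclusion formula. *)

theory Submission
  imports Defs
begin

section \<open>Algebra of positive linear idempotents below the identity\<close>

definition order_projection :: "('a::riesz_space \<Rightarrow> 'a) \<Rightarrow> bool" where
  "order_projection P \<longleftrightarrow>
     linear P \<and> (\<forall>x. P (P x) = P x) \<and> (\<forall>x\<ge>0. 0 \<le> P x \<and> P x \<le> x)"

lemma order_projectionD:
  assumes "order_projection P"
  shows "linear P" "P (P x) = P x" "0 \<le> x \<Longrightarrow> 0 \<le> P x" "0 \<le> x \<Longrightarrow> P x \<le> x"
  using assms by (auto simp: order_projection_def)

lemma order_projection_mono:
  assumes "order_projection P" "x \<le> y"
  shows "P x \<le> P y"
  using order_projectionD(3)[OF assms(1), of "y - x"] assms(2)
  by (simp add: linear_diff[OF order_projectionD(1)[OF assms(1)]])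

lemma order_projection_abs_le:
  assumes "order_projection P"
  shows "\<bar>P x\<bar> \<le> P \<bar>x\<bar>"
proof (rule abs_leI)
  show "P x \<le> P \<bar>x\<bar>"
    by (rule order_projection_mono[OF assms abs_ge_self])
  show "- P x \<le> P \<bar>x\<bar>"
    using order_projection_mono[OF assms abs_ge_minus_self[of x]]
    by (simp add: linear_neg[OF order_projectionD(1)[OF assms]])
qed

text \<open>Makes every statement about \<open>P\<close> available for \<open>I - P\<close> as well;
  a fixed point of \<open>P\<close> is exactly a vector that \<open>I - P\<close> kills.\<close>

lemma order_projection_complement:
  assumes "order_projection P"
  shows "order_projection (\<lambda>x. x - P x)"
  using order_projectionD[OF assms]
  by (auto simp: order_projection_def linear_diff linear_compose_sub[OF linear_ident])

lemma order_projection_0: "order_projection (\<lambda>x. 0)"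
  by (auto simp: order_projection_def linear_zero)

lemma order_projection_fixes_abs:
  assumes "order_projection P" "P x = x"
  shows "P \<bar>x\<bar> = \<bar>x\<bar>"
  using order_projection_abs_le[OF assms(1), of x] assms(2)
    order_projectionD(4)[OF assms(1), of "\<bar>x\<bar>"]
  by (simp add: order.antisym)

text \<open>The positive operator \<open>I - P\<close> kills \<bar>y\<bar>, hence everything
  dominated by it. This is the solidity of the range of \<open>P\<close>.\<close>

lemma order_projection_fixes_abs_le:
  assumes P: "order_projection P" and y: "P y = y" and le: "\<bar>x\<bar> \<le> \<bar>y\<bar>"
  shows "P x = x"
proof -
  let ?R = "\<lambda>x. x - P x"
  have R: "order_projection ?R"
    by (rule order_projection_complement[OF P])
  have "\<bar>?R x\<bar> \<le> ?R \<bar>x\<bar>"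
    by (rule order_projection_abs_le[OF R])
  also have "\<dots> \<le> ?R \<bar>y\<bar>"
    by (rule order_projection_mono[OF R le])
  also have "\<dots> = 0"
    using order_projection_fixes_abs[OF P y] by simp
  finally show ?thesis by simp
qed

text \<open>For x \<ge> 0 the vector \<open>Q (P x)\<close> lies between 0 and \<open>P x\<close>, a
  fixed point of \<open>P\<close>, so solidity makes it a fixed point too. Linearity extends this to
  all x.\<close>

lemma order_projection_absorb:
  assumes P: "order_projection P" and Q: "order_projection Q"
  shows "P (Q (P x)) = Q (P x)"
proof -
  have pos: "P (Q (P x)) = Q (P x)" if "0 \<le> x" for x
  proof (rule order_projection_fixes_abs_le[OF P])
    show "P (P x) = P x"
      by (rule order_projectionD[OF P])
    have "0 \<le> P x"
      using that by (rule order_projectionD[OF P])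
    then show "\<bar>Q (P x)\<bar> \<le> \<bar>P x\<bar>"
      using order_projectionD[OF Q] by simp
  qed
  \<comment> \<open>\<open>nprt x\<close> is the negative part with its sign, so x is the difference
    of the positive vectors \<open>pprt x\<close> and \<open>- nprt x\<close>.\<close>
  have "P (Q (P (pprt x - (- nprt x)))) = Q (P (pprt x - (- nprt x)))"
    using pos[of "pprt x"] pos[of "- nprt x"]
    by (simp only: linear_diff[OF order_projectionD(1)[OF P]]
        linear_diff[OF order_projectionD(1)[OF Q]]) simp
  then show ?thesis
    using prts[of x] by simp
qed

text \<open>Absorption for \<open>P\<close> gives PQP = QP. Absorption for \<open>I - P\<close>
  gives PQ(I - P) = 0, that is, PQ = PQP.\<close>

lemma order_projection_commute:
  assumes P: "order_projection P" and Q: "order_projection Q"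
  shows "P (Q x) = Q (P x)"
  using order_projection_absorb[OF P Q, of x]
    order_projection_absorb[OF order_projection_complement[OF P] Q, of x]
  by (simp add: linear_diff[OF order_projectionD(1)[OF P]]
      linear_diff[OF order_projectionD(1)[OF Q]])

lemma order_projection_compose:
  assumes P: "order_projection P" and Q: "order_projection Q"
  shows "order_projection (\<lambda>x. P (Q x))"
  unfolding order_projection_def
proof (intro conjI allI impI)
  show "linear (\<lambda>x. P (Q x))"
    using linear_compose[OF order_projectionD(1)[OF Q] order_projectionD(1)[OF P]]
    by (simp add: o_def)
  show "P (Q (P (Q x))) = P (Q x)" for x
    using order_projection_commute[OF P Q] order_projectionD(2)[OF P] order_projectionD(2)[OF Q]
    by metis
  show "0 \<le> P (Q x)" if "0 \<le> x" for x
    using that order_projectionD[OF P] order_projectionD[OF Q] by blast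
  show "P (Q x) \<le> x" if "0 \<le> x" for x
    using that order_projectionD[OF P] order_projectionD[OF Q] by (meson order.trans)
qed

lemma range_order_projection:
  assumes "order_projection P"
  shows "range P = {x. P x = x}"
  using order_projectionD(2)[OF assms] by auto (metis rangeI)

lemma range_order_projection_compose:
  assumes P: "order_projection P" and Q: "order_projection Q"
  shows "range (\<lambda>x. P (Q x)) = range P \<inter> range Q"
  using order_projectionD(2)[OF P] order_projectionD(2)[OF Q] order_projection_commute[OF P Q]
  by (auto simp: range_order_projection[OF P] range_order_projection[OF Q]) (metis rangeI)

text \<open>The operator is I - (I - Q)(I - P), which sends x to \<open>P x + Q (x - P x)\<close>;
  one inclusion can be read off from this form.\<close>

lemma range_order_projection_join:
  assumes P: "order_projection P" and Q: "order_projection Q"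
  shows "range (\<lambda>x. x - (x - P x - Q (x - P x))) = {u + v | u v. u \<in> range P \<and> v \<in> range Q}"
    (is "range ?J = ?S")
proof (intro equalityI subsetI)
  fix w assume "w \<in> range ?J"
  then obtain x where "w = P x + Q (x - P x)"
    by (auto simp: add.commute)
  then show "w \<in> ?S" by blast
next
  fix w assume "w \<in> ?S"
  then obtain u v where w: "w = u + v" and uv: "P u = u" "Q v = v"
    by (auto simp: range_order_projection[OF P] range_order_projection[OF Q])
  \<comment> \<open>Commutation keeps \<open>P v\<close> in the range of \<open>Q\<close>, so
    \<open>Q\<close> fixes w - P w = v - P v, and w is recovered as P w + (w - P w).\<close>
  have "Q (P v) = P v"
    using order_projection_commute[OF P Q, of v] uv by simp
  then have "?J w = w"
    using uv by (simp add: w linear_diff[OF order_projectionD(1)[OF Q]]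
        linear_add[OF order_projectionD(1)[OF Q]] linear_add[OF order_projectionD(1)[OF P]])
  from this[symmetric] show "w \<in> range ?J"
    by (rule range_eqI)
qed

section \<open>From order projections to projection bands\<close>

lemma disjoint_complement_range:
  assumes P: "order_projection P"
  shows "disjoint_complement (range P) = {x. P x = 0}"
proof (intro equalityI subsetI)
  fix x assume x: "x \<in> disjoint_complement (range P)"
  have "P (P x) = P x"
    by (rule order_projectionD[OF P])
  then have "inf \<bar>x\<bar> \<bar>P x\<bar> = 0"
    using x by (auto simp: disjoint_complement_def)
  moreover have "\<bar>P x\<bar> \<le> \<bar>x\<bar>"
    using order_projection_abs_le[OF P, of x] order_projectionD(4)[OF P, of "\<bar>x\<bar>"] by simp
  ultimately show "x \<in> {x. P x = 0}"
    by (simp add: inf.absorb2)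
next
  fix x assume "x \<in> {x. P x = 0}"
  then have x: "P x = 0" by simp
  \<comment> \<open>The infimum is dominated by y, which \<open>P\<close> fixes, and by x, which
    \<open>I - P\<close> fixes. By solidity both operators fix it, so it is 0.\<close>
  have "inf \<bar>x\<bar> \<bar>y\<bar> = 0" if y: "P y = y" for y
  proof -
    let ?w = "inf \<bar>x\<bar> \<bar>y\<bar>"
    have w: "\<bar>?w\<bar> = ?w" by simp
    have "P ?w = ?w"
      by (rule order_projection_fixes_abs_le[OF P y]) (simp only: w inf_le2)
    moreover have "?w - P ?w = ?w"
      by (rule order_projection_fixes_abs_le[OF order_projection_complement[OF P], of x])
        (simp_all only: w inf_le1 x diff_0_right)
    ultimately show ?thesis by simp
  qed
  then show "x \<in> disjoint_complement (range P)"
    using range_order_projection[OF P] by (auto simp: disjoint_complement_def)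
qed

lemma subspace_range_order_projection:
  assumes "order_projection P"
  shows "subspace (range P)"
  using linear_subspace_image[OF order_projectionD(1)[OF assms] subspace_UNIV] .

text \<open>\<open>I - P\<close> kills every member of the net, so its value at the limit l is
  bounded in modulus by \<bar>x a - l\<bar>, hence by every \<open>y a\<close>.\<close>

lemma order_closed_range_order_projection:
  assumes P: "order_projection P"
  shows "order_closed (range P)"
  unfolding order_closed_def
proof (intro allI impI)
  fix I :: "'a set" and r x l
  assume x: "\<forall>a\<in>I. x a \<in> range P" and conv: "order_converges I r x l"
  let ?R = "\<lambda>x. x - P x"
  have R: "order_projection ?R"
    by (rule order_projection_complement[OF P])
  obtain y where y: "decreases_to_0 I r y" and le: "\<forall>a\<in>I. \<bar>x a - l\<bar> \<le> y a"
    using conv by (auto simp: order_converges_def)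
  have "\<bar>?R l\<bar> \<le> y a" if a: "a \<in> I" for a
  proof -
    have "?R l = - ?R (x a - l)"
      using x a by (auto simp: range_order_projection[OF P] linear_diff[OF order_projectionD(1)[OF P]])
    then have "\<bar>?R l\<bar> = \<bar>?R (x a - l)\<bar>"
      by (metis abs_minus_cancel)
    also have "\<dots> \<le> ?R \<bar>x a - l\<bar>"
      by (rule order_projection_abs_le[OF R])
    also have "\<dots> \<le> \<bar>x a - l\<bar>"
      by (rule order_projectionD(4)[OF R]) simp
    also have "\<dots> \<le> y a"
      using le a by blast
    finally show ?thesis .
  qed
  then have "\<bar>?R l\<bar> \<le> 0"
    using y unfolding decreases_to_0_def by blast
  then show "l \<in> range P"
    by (simp add: range_order_projection[OF P])
qed

lemma projection_band_range:
  assumes P: "order_projection P"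
  shows "projection_band (range P)"
  unfolding projection_band_def
proof (intro conjI allI)
  show "band (range P)"
    unfolding band_def riesz_ideal_def solid_def
    using subspace_range_order_projection[OF P] order_closed_range_order_projection[OF P]
      order_projection_fixes_abs_le[OF P]
    by (auto simp: range_order_projection[OF P])
  show "range P \<inter> disjoint_complement (range P) = {0}"
    using linear_0[OF order_projectionD(1)[OF P]]
    unfolding disjoint_complement_range[OF P] unfolding range_order_projection[OF P] by auto
  show "\<exists>u\<in>range P. \<exists>v\<in>disjoint_complement (range P). x = u + v" for x
    using order_projectionD(2)[OF P]
    by (intro bexI[of _ "P x"] bexI[of _ "x - P x"])
      (auto simp: disjoint_complement_range[OF P] linear_diff[OF order_projectionD(1)[OF P]])
qed

text \<open>Applying \<open>P\<close> to x = u + v with u fixed and v in the kernel returns u. Thus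
  an order projection is determined by its range, and a band projection can be identified by
  computing a range.\<close>

lemma band_projection_range:
  assumes P: "order_projection P"
  shows "band_projection (range P) = P"
proof
  fix x
  show "band_projection (range P) x = P x"
    unfolding band_projection_def
  proof (rule the_equality)
    show "P x \<in> range P \<and> (\<exists>v\<in>disjoint_complement (range P). x = P x + v)"
      using order_projectionD(2)[OF P, of x]
      by (intro conjI rangeI bexI[of _ "x - P x"])
        (simp_all add: disjoint_complement_range[OF P] linear_diff[OF order_projectionD(1)[OF P]])
    show "u = P x" if "u \<in> range P \<and> (\<exists>v\<in>disjoint_complement (range P). x = u + v)" for u
      using that unfolding disjoint_complement_range[OF P] unfolding range_order_projection[OF P]
      by (auto simp: linear_add[OF order_projectionD(1)[OF P]])
  qed
qed

section \<open>Disjoint complements are subspaces\<close>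

lemma inf_add_eq_0:
  fixes a b c :: "'a::riesz_space"
  assumes "0 \<le> a" "0 \<le> b" "0 \<le> c" "inf a c = 0" "inf b c = 0"
  shows "inf (a + b) c = 0"
proof -
  let ?w = "inf (a + b) c"
  \<comment> \<open>Subtracting a leaves something below both b and c, hence below 0. So
    \<open>?w\<close> is already below a, and a is disjoint from c.\<close>
  have "?w - a \<le> b"
    using inf_le1[of "a + b" c] by (simp add: diff_le_eq add.commute)
  moreover have "?w - a \<le> c"
    using inf_le2[of "a + b" c] assms(1) by (simp add: diff_le_eq add_increasing2)
  ultimately have "?w - a \<le> inf b c"
    by simp
  then have "?w \<le> inf a c"
    using assms(5) by simp
  then show ?thesis
    using assms by (intro order.antisym) auto
qed

lemma abs_scaleR_le:
  fixes x :: "'a::riesz_space"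
  shows "\<bar>c *\<^sub>R x\<bar> \<le> \<bar>c\<bar> *\<^sub>R \<bar>x\<bar>"
proof -
  have *: "\<bar>c *\<^sub>R x\<bar> \<le> c *\<^sub>R \<bar>x\<bar>" if "0 \<le> c" for c and x :: 'a
  proof (rule abs_leI)
    show "c *\<^sub>R x \<le> c *\<^sub>R \<bar>x\<bar>"
      using that by (intro scaleR_left_mono abs_ge_self)
    show "- (c *\<^sub>R x) \<le> c *\<^sub>R \<bar>x\<bar>"
      using scaleR_left_mono[OF abs_ge_minus_self[of x] that] by simp
  qed
  show ?thesis
    using *[of c x] *[of "- c" "- x"] by (cases "0 \<le> c") auto
qed

text \<open>Needed for uniqueness and linearity of the decomposition along a band and its disjoint
  complement.\<close>

lemma subspace_disjoint_complement:
  assumes "subspace B"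
  shows "subspace (disjoint_complement B)"
proof (rule subspaceI)
  show "0 \<in> disjoint_complement B"
    by (auto simp: disjoint_complement_def inf.absorb1)
next
  fix x y assume "x \<in> disjoint_complement B" "y \<in> disjoint_complement B"
  then have eq: "inf (\<bar>x\<bar> + \<bar>y\<bar>) \<bar>z\<bar> = 0" if "z \<in> B" for z
    using that by (intro inf_add_eq_0) (auto simp: disjoint_complement_def)
  have "inf \<bar>x + y\<bar> \<bar>z\<bar> = 0" if "z \<in> B" for z
  proof (rule order.antisym)
    show "inf \<bar>x + y\<bar> \<bar>z\<bar> \<le> 0"
      unfolding eq[OF that, symmetric] by (intro inf_mono abs_triangle_ineq order.refl)
  qed simp
  then show "x + y \<in> disjoint_complement B"
    by (simp add: disjoint_complement_def)
next
  fix c x assume x: "x \<in> disjoint_complement B"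
  have "inf \<bar>c *\<^sub>R x\<bar> \<bar>z\<bar> = 0" if z: "z \<in> B" for z
  proof (cases "c = 0")
    case True
    then show ?thesis by (simp add: inf.absorb1)
  next
    case False
    \<comment> \<open>Dividing by \<bar>c\<bar> moves the scalar from x to z, and the rescaled z
      stays in the subspace \<open>B\<close>, hence is disjoint from x.\<close>
    let ?w = "inf \<bar>c *\<^sub>R x\<bar> \<bar>z\<bar>" and ?d = "inverse \<bar>c\<bar>"
    have d: "0 \<le> ?d" by simp
    have "?d *\<^sub>R ?w \<le> ?d *\<^sub>R (\<bar>c\<bar> *\<^sub>R \<bar>x\<bar>)"
      using d abs_scaleR_le[of c x] by (intro scaleR_left_mono) (auto intro: le_infI1)
    then have "?d *\<^sub>R ?w \<le> \<bar>x\<bar>"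
      using False by simp
    moreover have "?d *\<^sub>R ?w \<le> \<bar>?d *\<^sub>R z\<bar>"
    proof -
      have "?d *\<^sub>R ?w \<le> ?d *\<^sub>R \<bar>z\<bar>"
        using d by (intro scaleR_left_mono) auto
      \<comment> \<open>z is written as a multiple of its rescaled version because
        \<open>abs_scaleR_le\<close> bounds the modulus of a multiple from above.\<close>
      also have "\<dots> = ?d *\<^sub>R \<bar>\<bar>c\<bar> *\<^sub>R (?d *\<^sub>R z)\<bar>"
        using False by simp
      also have "\<dots> \<le> ?d *\<^sub>R (\<bar>c\<bar> *\<^sub>R \<bar>?d *\<^sub>R z\<bar>)"
        using d abs_scaleR_le[of "\<bar>c\<bar>" "?d *\<^sub>R z"] by (intro scaleR_left_mono) auto
      also have "\<dots> = \<bar>?d *\<^sub>R z\<bar>"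
        using False by simp
      finally show ?thesis .
    qed
    moreover have "inf \<bar>x\<bar> \<bar>?d *\<^sub>R z\<bar> = 0"
      using x subspace_scale[OF assms z] by (auto simp: disjoint_complement_def)
    ultimately have "?d *\<^sub>R ?w \<le> 0"
      by (metis le_inf_iff)
    then have "\<bar>c\<bar> *\<^sub>R (?d *\<^sub>R ?w) \<le> \<bar>c\<bar> *\<^sub>R 0"
      by (intro scaleR_left_mono) auto
    then have "?w \<le> 0"
      using False by simp
    then show ?thesis
      by (intro order.antisym) auto
  qed
  then show "c *\<^sub>R x \<in> disjoint_complement B"
    by (simp add: disjoint_complement_def)
qed

section \<open>Band projections are order projections\<close>

context
  fixes B :: "'a::riesz_space set"
  assumes B: "projection_band B"
begin

lemma subspace_projection_band: "subspace B"
  using B by (simp add: projection_band_def band_def riesz_ideal_def)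

text \<open>The first components of two decompositions differ by a vector of both \<open>B\<close>
  and its disjoint complement, which meet only in 0.\<close>

lemma band_projection_eqI:
  assumes "u \<in> B" "v \<in> disjoint_complement B"
  shows "band_projection B (u + v) = u"
  unfolding band_projection_def
proof (rule the_equality)
  show "u \<in> B \<and> (\<exists>w\<in>disjoint_complement B. u + v = u + w)"
    using assms by blast
next
  fix u' assume "u' \<in> B \<and> (\<exists>w\<in>disjoint_complement B. u + v = u' + w)"
  then obtain v' where u': "u' \<in> B" "v' \<in> disjoint_complement B" "u + v = u' + v'"
    by blast
  then have "u' - u = v - v'"
    by (simp add: algebra_simps)
  moreover have "u' - u \<in> B"
    using assms u' by (intro subspace_diff subspace_projection_band)
  moreover have "v - v' \<in> disjoint_complement B"
    using assms u'
    by (intro subspace_diff subspace_disjoint_complement subspace_projection_band)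
  ultimately have "u' - u \<in> B \<inter> disjoint_complement B"
    by simp
  then show "u' = u"
    using B unfolding projection_band_def by auto
qed

lemma projection_band_cases:
  obtains u v where "x = u + v" "u \<in> B" "v \<in> disjoint_complement B"
  using B unfolding projection_band_def by blast

lemma linear_band_projection: "linear (band_projection B)"
proof (rule linearI)
  have D: "subspace (disjoint_complement B)"
    by (intro subspace_disjoint_complement subspace_projection_band)
  fix x y :: 'a and c :: real
  obtain u v where x: "x = u + v" "u \<in> B" "v \<in> disjoint_complement B"
    by (rule projection_band_cases)
  obtain u' v' where y: "y = u' + v'" "u' \<in> B" "v' \<in> disjoint_complement B"
    by (rule projection_band_cases)
  have "band_projection B ((u + u') + (v + v')) = u + u'"
    using x y D by (intro band_projection_eqI subspace_add subspace_projection_band)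
  moreover have "x + y = (u + u') + (v + v')"
    using x y by (simp add: algebra_simps)
  ultimately show "band_projection B (x + y) = band_projection B x + band_projection B y"
    using x y by (metis band_projection_eqI)
  have "band_projection B (c *\<^sub>R u + c *\<^sub>R v) = c *\<^sub>R u"
    using x D by (intro band_projection_eqI subspace_scale subspace_projection_band)
  then show "band_projection B (c *\<^sub>R x) = c *\<^sub>R band_projection B x"
    using x by (simp add: band_projection_eqI scaleR_add_right)
qed

lemma band_projection_fixes:
  assumes "u \<in> B"
  shows "band_projection B u = u"
  using band_projection_eqI[OF assms subspace_0[OF subspace_disjoint_complement[OF
        subspace_projection_band]]] by simp

lemma order_projection_band_projection: "order_projection (band_projection B)"
  unfolding order_projection_def
proof (intro conjI allI impI)
  show "linear (band_projection B)"
    by (rule linear_band_projection)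
next
  fix x :: 'a
  obtain u v where x: "x = u + v" "u \<in> B" "v \<in> disjoint_complement B"
    by (rule projection_band_cases)
  then have Px: "band_projection B x = u"
    by (simp add: band_projection_eqI)
  then show "band_projection B (band_projection B x) = band_projection B x"
    using x band_projection_fixes by simp
  assume "0 \<le> x"
  \<comment> \<open>From u + v \<ge> 0 follow -u \<le> v and -v \<le> u. Hence -u and -v both lie
    below the infimum of \<bar>u\<bar> and \<bar>v\<bar>, which is 0.\<close>
  then have "- u + 0 \<le> - u + x" "- v + 0 \<le> - v + x"
    by (auto intro: add_left_mono)
  then have "- u \<le> v" "- v \<le> u"
    by (simp_all add: x(1) add.commute[of u v])
  then have "- u \<le> inf \<bar>v\<bar> \<bar>u\<bar>" "- v \<le> inf \<bar>v\<bar> \<bar>u\<bar>"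
    by (auto intro: order.trans abs_ge_self abs_ge_minus_self)
  moreover have "inf \<bar>v\<bar> \<bar>u\<bar> = 0"
    using x by (auto simp: disjoint_complement_def)
  ultimately have "0 \<le> u" "0 \<le> v"
    by (simp_all only: neg_le_0_iff_le)
  then show "0 \<le> band_projection B x" "band_projection B x \<le> x"
    using Px x(1) by simp_all
qed

text \<open>Carries the results on ranges of order projections over to arbitrary projection
  bands.\<close>

lemma range_band_projection: "range (band_projection B) = B"
proof (intro equalityI subsetI)
  fix y assume "y \<in> range (band_projection B)"
  then obtain x where y: "y = band_projection B x" by blast
  obtain u v where "x = u + v" "u \<in> B" "v \<in> disjoint_complement B"
    by (rule projection_band_cases)
  then show "y \<in> B"
    using y by (simp add: band_projection_eqI)
next
  fix y assume "y \<in> B"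
  then show "y \<in> range (band_projection B)"
    using band_projection_fixes by (metis rangeI)
qed

end

section \<open>Intersections and sums of projection bands\<close>

lemma projection_band_Int:
  assumes "projection_band B" "projection_band C"
  shows "projection_band (B \<inter> C)"
    and "band_projection (B \<inter> C) = (\<lambda>x. band_projection B (band_projection C x))"
proof -
  note P = order_projection_band_projection[OF assms(1)]
    and Q = order_projection_band_projection[OF assms(2)]
  note PQ = order_projection_compose[OF P Q]
  \<comment> \<open>The composite is an order projection, so knowing its range gives both
    claims.\<close>
  have range: "range (\<lambda>x. band_projection B (band_projection C x)) = B \<inter> C"
    using range_order_projection_compose[OF P Q] assms by (simp add: range_band_projection)
  show "projection_band (B \<inter> C)"
    using projection_band_range[OF PQ] by (simp only: range)
  show "band_projection (B \<inter> C) = (\<lambda>x. band_projection B (band_projection C x))"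
    using band_projection_range[OF PQ] by (simp only: range)
qed

text \<open>The second claim says that the complementary projection of a sum is the product of the
  complementary projections, the form in which an induction can multiply one factor at a
  time.\<close>

lemma projection_band_sum:
  assumes "projection_band B" "projection_band C"
  shows "projection_band {u + v | u v. u \<in> B \<and> v \<in> C}"
    and "z - band_projection {u + v | u v. u \<in> B \<and> v \<in> C} z =
      (z - band_projection B z) - band_projection C (z - band_projection B z)"
proof -
  let ?J = "\<lambda>x. x - (x - band_projection B x - band_projection C (x - band_projection B x))"
  note P = order_projection_band_projection[OF assms(1)]
    and Q = order_projection_band_projection[OF assms(2)]
  have J: "order_projection ?J"
    using order_projection_complement[OF order_projection_compose[OF
          order_projection_complement[OF Q] order_projection_complement[OF P]]] .
  have range: "range ?J = {u + v | u v. u \<in> B \<and> v \<in> C}"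
    using range_order_projection_join[OF P Q] assms by (simp only: range_band_projection)
  show "projection_band {u + v | u v. u \<in> B \<and> v \<in> C}"
    using projection_band_range[OF J] by (simp only: range)
  have "band_projection {u + v | u v. u \<in> B \<and> v \<in> C} = ?J"
    using band_projection_range[OF J] by (simp only: range)
  then show "z - band_projection {u + v | u v. u \<in> B \<and> v \<in> C} z =
      (z - band_projection B z) - band_projection C (z - band_projection B z)"
    by simp
qed

text \<open>{0} is the range of the zero operator. It is the empty sum of bands, where the induction
  starts.\<close>

lemma projection_band_zero:
  fixes z :: "'a::riesz_space"
  shows "projection_band {0::'a}" "band_projection {0} z = 0"
  using projection_band_range[OF order_projection_0[where 'a='a]]
    band_projection_range[OF order_projection_0[where 'a='a]]
  by (simp_all add: fun_eq_iff)

lemma projection_band_UNIV: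
  fixes z :: "'a::riesz_space"
  shows "projection_band (UNIV :: 'a set)" "band_projection UNIV z = z"
  using order_projection_complement[OF order_projection_0[where 'a='a]]
    projection_band_range[of "\<lambda>x::'a. x"] band_projection_range[of "\<lambda>x::'a. x"]
  by (simp_all add: fun_eq_iff)

lemma projection_band_INT:
  assumes "finite J" "\<And>i. i \<in> J \<Longrightarrow> projection_band (B i)"
  shows "projection_band (\<Inter>i\<in>J. B i)"
  using assms by (induction J) (simp_all add: projection_band_UNIV projection_band_Int)

section \<open>Expanding the product over a finite index set\<close>

lemma set_sum_insert:
  assumes "finite A" "a \<notin> A"
  shows "{\<Sum>i\<in>insert a A. x i | x. \<forall>i\<in>insert a A. x i \<in> B i} =
    {u + v | u v. u \<in> {\<Sum>i\<in>A. x i | x. \<forall>i\<in>A. x i \<in> B i} \<and> v \<in> (B a :: 'a::comm_monoid_add set)}"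
    (is "?L = ?R")
proof (intro equalityI subsetI)
  fix w assume "w \<in> ?L"
  then obtain x where "w = (\<Sum>i\<in>A. x i) + x a" "\<forall>i\<in>insert a A. x i \<in> B i"
    using assms by (auto simp: add.commute)
  then show "w \<in> ?R"
    by blast
next
  fix w assume "w \<in> ?R"
  then obtain x v where w: "w = (\<Sum>i\<in>A. x i) + v" "\<forall>i\<in>A. x i \<in> B i" "v \<in> B a"
    by blast
  \<comment> \<open>Since a is not in \<open>A\<close>, the value at a can be set to v without
    changing the sum over \<open>A\<close>.\<close>
  have "(\<Sum>i\<in>A. (x(a := v)) i) = (\<Sum>i\<in>A. x i)"
    using assms by (intro sum.cong) auto
  then have "w = (\<Sum>i\<in>insert a A. (x(a := v)) i)"
    using assms w by (simp add: add.commute)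
  moreover have "\<forall>i\<in>insert a A. (x(a := v)) i \<in> B i"
    using w by auto
  ultimately show "w \<in> ?L" by blast
qed

text \<open>The empty set contributes the identity, since \<open>(\<Inter>i\<in>{}. B i) = UNIV\<close>.\<close>

lemma projection_band_set_sum:
  assumes "finite A" "\<And>i. i \<in> A \<Longrightarrow> projection_band (B i)"
  shows "projection_band {\<Sum>i\<in>A. x i | x. \<forall>i\<in>A. x i \<in> B i} \<and>
    (\<forall>z. z - band_projection {\<Sum>i\<in>A. x i | x. \<forall>i\<in>A. x i \<in> B i} z =
      (\<Sum>J\<in>Pow A. (- 1) ^ card J *\<^sub>R band_projection (\<Inter>i\<in>J. B i) z))"
  using assms
proof (induction A)
  case empty
  then show ?case
    by (simp add: projection_band_zero projection_band_UNIV)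
next
  case (insert a A)
  let ?S = "{\<Sum>i\<in>A. x i | x. \<forall>i\<in>A. x i \<in> B i}"
  let ?f = "\<lambda>z J. (- 1) ^ card J *\<^sub>R band_projection (\<Inter>i\<in>J. B i) z"
  have S: "projection_band ?S" "\<And>z. z - band_projection ?S z = (\<Sum>J\<in>Pow A. ?f z J)"
    using insert by auto
  have Ba: "projection_band (B a)"
    using insert by simp
  note lin = linear_band_projection[OF Ba]
  have step: "?f z (insert a J) = - band_projection (B a) (?f z J)" if J: "J \<in> Pow A" for J z
  proof -
    have fin: "finite J" and "a \<notin> J"
      using J insert.hyps finite_subset by auto
    moreover have "projection_band (\<Inter>i\<in>J. B i)"
      using J insert.prems by (intro projection_band_INT fin) auto
    ultimately show ?thesis
      using projection_band_Int(2)[OF Ba] by (simp add: linear_scale[OF lin])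
  qed
  \<comment> \<open>The subsets avoiding a sum to (I - P)z, where P projects onto \<open>?S\<close>;
    those containing a sum to minus the projection of this onto \<open>B a\<close>.\<close>
  have "(\<Sum>J\<in>Pow (insert a A). ?f z J) =
      (z - band_projection ?S z) - band_projection (B a) (z - band_projection ?S z)" for z
  proof -
    have "inj_on (insert a) (Pow A)"
      using insert.hyps unfolding inj_on_def by (metis PowD insert_ident subsetD)
    then have "(\<Sum>J\<in>insert a ` Pow A. ?f z J) = (\<Sum>J\<in>Pow A. ?f z (insert a J))"
      by (simp add: sum.reindex)
    also have "\<dots> = - band_projection (B a) (\<Sum>J\<in>Pow A. ?f z J)"
      by (simp only: sum.cong[OF refl step] sum_negf linear_sum[OF lin])
    finally have "(\<Sum>J\<in>insert a ` Pow A. ?f z J) =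
        - band_projection (B a) (z - band_projection ?S z)"
      by (simp only: S(2))
    moreover have "(\<Sum>J\<in>Pow (insert a A). ?f z J) =
        (\<Sum>J\<in>Pow A. ?f z J) + (\<Sum>J\<in>insert a ` Pow A. ?f z J)"
      unfolding Pow_insert using insert.hyps by (intro sum.union_disjoint) auto
    ultimately show ?thesis
      by (simp only: S(2)) simp
  qed
  then show ?case
    unfolding set_sum_insert[OF insert.hyps] using projection_band_sum[OF S(1) Ba] by simp
qed

section \<open>Grouping the expansion by the number of bands\<close>

theorem lemma4p1:
  fixes B :: "nat \<Rightarrow> 'a::riesz_space set" and n :: nat
  assumes "n \<ge> 1"
    and "\<And>i. i \<in> {1..n} \<Longrightarrow> projection_band (B i)"
  shows "projection_band {\<Sum>i=1..n. x i | x. \<forall>i\<in>{1..n}. x i \<in> B i} \<and>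
    band_projection {\<Sum>i=1..n. x i | x. \<forall>i\<in>{1..n}. x i \<in> B i} =
      (\<lambda>z. \<Sum>k=1..n. (- 1) ^ (k - 1) *\<^sub>R
         (\<Sum>J | J \<subseteq> {1..n} \<and> card J = k. band_projection (\<Inter>i\<in>J. B i) z))"
proof -
  let ?S = "{\<Sum>i=1..n. x i | x. \<forall>i\<in>{1..n}. x i \<in> B i}"
  let ?P = "\<lambda>z J. band_projection (\<Inter>i\<in>J. B i) z"
  have S: "projection_band ?S"
    "\<And>z. z - band_projection ?S z = (\<Sum>J\<in>Pow {1..n}. (- 1) ^ card J *\<^sub>R ?P z J)"
    using projection_band_set_sum[of "{1..n}" B] assms(2) by auto
  have "band_projection ?S z =
      (\<Sum>k=1..n. (- 1) ^ (k - 1) *\<^sub>R (\<Sum>J | J \<subseteq> {1..n} \<and> card J = k. ?P z J))" for z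
  proof -
    \<comment> \<open>The empty set contributes z, which cancels against the z on the left. Only
      nonempty \<open>J\<close> remain, so \<open>card J - 1\<close> is never truncated.\<close>
    let ?N = "Pow {1..n} - {{}}"
    have card_pos: "0 < card J" if "J \<in> ?N" for J
      using that finite_subset[of J "{1..n}"] by (auto simp: card_gt_0_iff)
    have "z - band_projection ?S z = z + (\<Sum>J\<in>?N. (- 1) ^ card J *\<^sub>R ?P z J)"
      using sum.remove[of "Pow {1..n}" "{}" "\<lambda>J. (- 1) ^ card J *\<^sub>R ?P z J"]
      by (simp only: S(2)) (simp add: projection_band_UNIV)
    then have "- band_projection ?S z = (\<Sum>J\<in>?N. (- 1) ^ card J *\<^sub>R ?P z J)"
      by (simp only: diff_conv_add_uminus add_left_cancel)
    then have "band_projection ?S z = - (\<Sum>J\<in>?N. (- 1) ^ card J *\<^sub>R ?P z J)"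
      by (rule minus_equation_iff[THEN iffD1, symmetric])
    also have "\<dots> = (\<Sum>J\<in>?N. (- 1) ^ (card J - 1) *\<^sub>R ?P z J)"
      unfolding sum_negf[symmetric]
    proof (rule sum.cong[OF refl])
      fix J assume "J \<in> ?N"
      then have "card J = Suc (card J - 1)"
        using card_pos by simp
      then have "(- 1 :: real) ^ card J = - ((- 1) ^ (card J - 1))"
        by (metis power_Suc mult_minus1)
      then show "- ((- 1) ^ card J *\<^sub>R ?P z J) = (- 1) ^ (card J - 1) *\<^sub>R ?P z J"
        by simp
    qed
    \<comment> \<open>The nonempty subsets are sorted by cardinality, which ranges over 1 to
      n.\<close>
    also have "\<dots> = (\<Sum>k=1..n. \<Sum>J | J \<in> ?N \<and> card J = k. (- 1) ^ (card J - 1) *\<^sub>R ?P z J)"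
    proof (rule sum.group[symmetric])
      show "card ` ?N \<subseteq> {1..n}"
      proof (rule image_subsetI)
        fix J assume J: "J \<in> ?N"
        then have "card J \<le> n"
          using card_mono[of "{1..n}" J] by simp
        then show "card J \<in> {1..n}"
          using card_pos[OF J] by simp
      qed
    qed simp_all
    \<comment> \<open>As k \<ge> 1, a set of cardinality k is automatically nonempty, so the two
      inner index sets agree.\<close>
    also have "\<dots> = (\<Sum>k=1..n. (- 1) ^ (k - 1) *\<^sub>R (\<Sum>J | J \<subseteq> {1..n} \<and> card J = k. ?P z J))"
      unfolding scaleR_sum_right by (intro sum.cong) auto
    finally show ?thesis .
  qed
  with S(1) show ?thesis by blast
qed

end
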